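(* Let $a_1,a_2,a_3$ be distinct non-null points such that the lines $a_1a_2$ and $a_1a_3$ are non-null. Let $q_1\equiv q(a_2,a_3)$, $q_2\equiv q(a_1,a_3)$, $q_3\equiv q(a_1,a_2)$ be the quadrances and $S_1\equiv S(a_1a_2,a_1a_3)$ the spread. Then $$(q_2q_3S_1-q_1-q_2-q_3+2)^2=4(1-q_1)(1-q_2)(1-q_3).$$
   Context: Let $\mathbb F$ be a field of characteristic not two. A 3-proportion $x:y:z$ is a triple of elements of $\mathbb F$, not all zero, up to a common non-zero scalar. A point $a=[x:y:z]$ and a line $L=(l:m:n)$ are both 3-proportions. The point $[x:y:z]$ lies on the line $(l:m:n)$ when $lx+my-nz=0$. For distinct points $a,b$, the join $ab$ is the unique line through both. A point $[x:y:z]$ is null when $x^2+y^2-z^2=0$; a line $(l:m:n)$ is null when $l^2+m^2-n^2=0$. The quadrance between non-null points $a_1=[x_1:y_1:z_1]$, $a_2=[x_2:y_2:z_2]$ is $$q(a_1,a_2)=1-\frac{(x_1x_2+y_1y_2-z_1z_2)^2}{(x_1^2+y_1^2-z_1^2)(x_2^2+y_2^2-z_2^2)}.$$ The spread between non-null lines $L_1=(l_1:m_1:n_1)$, $L_2=(l_2:m_2:n_2)$ is $$S(L_1,L_2)=1-\frac{(l_1l_2+m_1m_2-n_1n_2)^2}{(l_1^2+m_1^2-n_1^2)(l_2^2+m_2^2-n_2^2)}.$$ Quadrances involving null points and spreads involving null lines are undefined. *)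

theory Defs
  imports Main
begin

definition proportional :: "'a::field \<times> 'a \<times> 'a \<Rightarrow> 'a \<times> 'a \<times> 'a \<Rightarrow> bool" where
  "proportional u v \<longleftrightarrow> u \<noteq> (0, 0, 0) \<and> v \<noteq> (0, 0, 0) \<and>
     (case u of (x, y, z) \<Rightarrow> \<exists>c. c \<noteq> 0 \<and> v = (c * x, c * y, c * z))"

lemma proportionalE:
  assumes "proportional u v"
  obtains x y z c where "u = (x, y, z)" "v = (c * x, c * y, c * z)" "c \<noteq> 0"
  using assms unfolding proportional_def by (cases u) auto

lemma proportional_refl: "u \<noteq> (0, 0, 0) \<Longrightarrow> proportional u u"
  unfolding proportional_def by (cases u) (auto intro!: exI[of _ 1])

lemma part_equivp_proportional: "part_equivp (proportional :: 'a::field \<times> 'a \<times> 'a \<Rightarrow> _)"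
proof (rule part_equivpI)
  have "proportional (1, 0, 0) (1, 0, 0 :: 'a)"
    by (rule proportional_refl) simp
  then show "\<exists>u :: 'a \<times> 'a \<times> 'a. proportional u u" by blast
  show "symp (proportional :: 'a \<times> 'a \<times> 'a \<Rightarrow> _)"
  proof (rule sympI)
    fix u v :: "'a \<times> 'a \<times> 'a"
    assume uv: "proportional u v"
    then obtain x y z c where *: "u = (x, y, z)" "v = (c * x, c * y, c * z)" "c \<noteq> 0"
      by (rule proportionalE)
    have "\<exists>d. d \<noteq> 0 \<and> (x, y, z) = (d * (c * x), d * (c * y), d * (c * z))"
      using *(3) by (intro exI[of _ "inverse c"]) (simp flip: mult.assoc)
    then show "proportional v u"
      using uv * unfolding proportional_def by simp
  qed
  show "transp (proportional :: 'a \<times> 'a \<times> 'a \<Rightarrow> _)"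
  proof (rule transpI)
    fix u v w :: "'a \<times> 'a \<times> 'a"
    assume uv: "proportional u v" and vw: "proportional v w"
    obtain x y z c where *: "u = (x, y, z)" "v = (c * x, c * y, c * z)" "c \<noteq> 0"
      using uv by (rule proportionalE)
    obtain d where d: "d \<noteq> 0" "w = (d * (c * x), d * (c * y), d * (c * z))"
      using vw * unfolding proportional_def by auto
    then have "\<exists>e. e \<noteq> 0 \<and> w = (e * x, e * y, e * z)"
      using *(3) by (intro exI[of _ "d * c"]) (simp add: mult.assoc)
    then show "proportional u w"
      using uv vw * unfolding proportional_def by simp
  qed
qed

text \<open>The projective plane over \<open>'a\<close>: non-zero triples up to a common non-zero scalar.\<close>

quotient_type (overloaded) 'a proportion = "'a::field \<times> 'a \<times> 'a" / partial: proportional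
  by (rule part_equivp_proportional)

type_synonym 'a point = "'a proportion"
type_synonym 'a line = "'a proportion"

text \<open>The minus sign makes the point \<open>[x : y : z]\<close> lie on the line with the same coordinates
  exactly when it is null.\<close>

lift_definition lies_on :: "'a::field point \<Rightarrow> 'a line \<Rightarrow> bool"
  is "\<lambda>(x, y, z) (l, m, n). l * x + m * y - n * z = 0"
proof -
  fix u u' v v' :: "'a \<times> 'a \<times> 'a"
  assume "proportional u u'" "proportional v v'"
  then obtain x y z c l m n d where *: "u = (x, y, z)" "u' = (c * x, c * y, c * z)" "c \<noteq> 0"
      "v = (l, m, n)" "v' = (d * l, d * m, d * n)" "d \<noteq> 0"
    by (elim proportionalE)
  have "d * l * (c * x) + d * m * (c * y) - d * n * (c * z)
      = (c * d) * (l * x + m * y - n * z)"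
    by (simp add: algebra_simps)
  with * show "(case u of (x, y, z) \<Rightarrow> \<lambda>(l, m, n). l * x + m * y - n * z = 0) v
      = (case u' of (x, y, z) \<Rightarrow> \<lambda>(l, m, n). l * x + m * y - n * z = 0) v'"
    by (simp del: right_minus_eq)
qed

definition join :: "'a::field point \<Rightarrow> 'a point \<Rightarrow> 'a line" where
  "join a b = (THE L. lies_on a L \<and> lies_on b L)"

lift_definition null_point :: "'a::field point \<Rightarrow> bool"
  is "\<lambda>(x, y, z). x\<^sup>2 + y\<^sup>2 - z\<^sup>2 = 0"
proof -
  fix u u' :: "'a \<times> 'a \<times> 'a"
  assume "proportional u u'"
  then obtain x y z c where *: "u = (x, y, z)" "u' = (c * x, c * y, c * z)" "c \<noteq> 0"
    by (elim proportionalE)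
  have "(c * x)\<^sup>2 + (c * y)\<^sup>2 - (c * z)\<^sup>2 = c\<^sup>2 * (x\<^sup>2 + y\<^sup>2 - z\<^sup>2)"
    by (simp add: algebra_simps power_mult_distrib)
  with * show "(case u of (x, y, z) \<Rightarrow> x\<^sup>2 + y\<^sup>2 - z\<^sup>2 = 0)
      = (case u' of (x, y, z) \<Rightarrow> x\<^sup>2 + y\<^sup>2 - z\<^sup>2 = 0)"
    by (simp del: right_minus_eq)
qed

lift_definition null_line :: "'a::field line \<Rightarrow> bool"
  is "\<lambda>(l, m, n). l\<^sup>2 + m\<^sup>2 - n\<^sup>2 = 0"
  by (rule null_point.rsp[unfolded rel_fun_def, rule_format])

lemma quadrance_scale:
  fixes c d :: "'a::field"
  assumes "c \<noteq> 0" "d \<noteq> 0"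
  shows "((c * x\<^sub>1) * (d * x\<^sub>2) + (c * y\<^sub>1) * (d * y\<^sub>2) - (c * z\<^sub>1) * (d * z\<^sub>2))\<^sup>2 /
      (((c * x\<^sub>1)\<^sup>2 + (c * y\<^sub>1)\<^sup>2 - (c * z\<^sub>1)\<^sup>2) * ((d * x\<^sub>2)\<^sup>2 + (d * y\<^sub>2)\<^sup>2 - (d * z\<^sub>2)\<^sup>2))
    = (x\<^sub>1 * x\<^sub>2 + y\<^sub>1 * y\<^sub>2 - z\<^sub>1 * z\<^sub>2)\<^sup>2 /
      ((x\<^sub>1\<^sup>2 + y\<^sub>1\<^sup>2 - z\<^sub>1\<^sup>2) * (x\<^sub>2\<^sup>2 + y\<^sub>2\<^sup>2 - z\<^sub>2\<^sup>2))"
    (is "?N / ?D = ?n / ?d")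
proof -
  have "?N = (c * d)\<^sup>2 * ?n" "?D = (c * d)\<^sup>2 * ?d"
    by (simp_all add: algebra_simps power2_eq_square)
  then show ?thesis using assms by simp
qed

text \<open>
  Quadrance is meaningful only for non-null points and spread only for non-null lines; on other
  arguments the denominator is \<open>0\<close> and both functions take the meaningless value \<open>1\<close>.
\<close>

lift_definition quadrance :: "'a::field point \<Rightarrow> 'a point \<Rightarrow> 'a"
  is "\<lambda>(x\<^sub>1, y\<^sub>1, z\<^sub>1) (x\<^sub>2, y\<^sub>2, z\<^sub>2).
    1 - (x\<^sub>1 * x\<^sub>2 + y\<^sub>1 * y\<^sub>2 - z\<^sub>1 * z\<^sub>2)\<^sup>2 /
        ((x\<^sub>1\<^sup>2 + y\<^sub>1\<^sup>2 - z\<^sub>1\<^sup>2) * (x\<^sub>2\<^sup>2 + y\<^sub>2\<^sup>2 - z\<^sub>2\<^sup>2))"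
  by (elim proportionalE) (simp add: quadrance_scale)

lift_definition spread :: "'a::field line \<Rightarrow> 'a line \<Rightarrow> 'a"
  is "\<lambda>(l\<^sub>1, m\<^sub>1, n\<^sub>1) (l\<^sub>2, m\<^sub>2, n\<^sub>2).
    1 - (l\<^sub>1 * l\<^sub>2 + m\<^sub>1 * m\<^sub>2 - n\<^sub>1 * n\<^sub>2)\<^sup>2 /
        ((l\<^sub>1\<^sup>2 + m\<^sub>1\<^sup>2 - n\<^sub>1\<^sup>2) * (l\<^sub>2\<^sup>2 + m\<^sub>2\<^sup>2 - n\<^sub>2\<^sup>2))"
  by (elim proportionalE) (simp add: quadrance_scale)

text \<open>The description in \<open>join\<close> is proper for distinct points.\<close>

lemma proportional_if_cross_eq_0:
  fixes x y z :: "'a::field"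
  assumes "(x, y, z) \<noteq> (0, 0, 0)" "(x', y', z') \<noteq> (0, 0, 0)"
    and "y * z' = z * y'" "z * x' = x * z'" "x * y' = y * x'"
  shows "proportional (x, y, z) (x', y', z')"
proof -
  have "\<exists>c. x' = c * x \<and> y' = c * y \<and> z' = c * z"
  proof -
    consider "x \<noteq> 0" | "y \<noteq> 0" | "z \<noteq> 0" using assms(1) by auto
    then show ?thesis
    proof cases
      case 1
      then show ?thesis using assms(3-5)
        by (intro exI[of _ "x' / x"]) (simp add: field_simps)
    next
      case 2
      then show ?thesis using assms(3-5)
        by (intro exI[of _ "y' / y"]) (simp add: field_simps)
    next
      case 3
      then show ?thesis using assms(3-5)
        by (intro exI[of _ "z' / z"]) (simp add: field_simps)
    qed
  qed
  with assms(1,2) show ?thesis unfolding proportional_def by auto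
qed

lemma ex1_join:
  fixes a b :: "'a::field point"
  assumes "a \<noteq> b"
  shows "\<exists>!L. lies_on a L \<and> lies_on b L"
proof -
  have "\<exists>L. (lies_on a L \<and> lies_on b L) \<and> (\<forall>M. lies_on a M \<and> lies_on b M \<longrightarrow> L = M)"
    using assms
  proof transfer
    fix a b :: "'a \<times> 'a \<times> 'a"
    let ?on = "\<lambda>(x, y, z) (l, m, n). l * x + m * y - n * z = (0 :: 'a)"
    assume "proportional a a" "proportional b b" and ab: "\<not> proportional a b"
    obtain x y z x' y' z' where a: "a = (x, y, z)" and b: "b = (x', y', z')"
      by (cases a, cases b)
    define l m n where "l = y * z' - z * y'" and "m = z * x' - x * z'" and "n = y * x' - x * y'"
    note k_def = l_def m_def n_def
    have "(x, y, z) \<noteq> (0, 0, 0)" "(x', y', z') \<noteq> (0, 0, 0)"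
      using \<open>proportional a a\<close> \<open>proportional b b\<close> a b unfolding proportional_def by auto
    then have nz: "(l, m, n) \<noteq> (0, 0, 0)"
      using ab proportional_if_cross_eq_0[of x y z x' y' z'] a b by (auto simp: k_def)
    have on: "?on a (l, m, n)" "?on b (l, m, n)"
      by (simp_all add: a b k_def algebra_simps)
    have uniq: "proportional (l, m, n) L"
      if "proportional L L" and L: "?on a L" "?on b L" for L
    proof -
      obtain l' m' n' where L': "L = (l', m', n')" by (cases L)
      have 1: "l' * x + m' * y = n' * z" "l' * x' + m' * y' = n' * z'"
        using L by (simp_all add: a b L')
      have "m * n' = n * m'" "n * l' = l * n'" "l * m' = m * l'"
        using 1 unfolding k_def by algebra+
      moreover have "L \<noteq> (0, 0, 0)" using \<open>proportional L L\<close> by (simp add: proportional_def)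
      ultimately show ?thesis
        using nz by (auto simp: L' intro: proportional_if_cross_eq_0)
    qed
    show "\<exists>L\<in>{L. proportional L L}. (?on a L \<and> ?on b L) \<and>
        (\<forall>M\<in>{M. proportional M M}. ?on a M \<and> ?on b M \<longrightarrow> proportional L M)"
      using on uniq proportional_refl[OF nz] by (intro bexI[of _ "(l, m, n)"]) blast+
  qed
  then show ?thesis by blast
qed

end

theory Submission
  imports Defs
begin

text \<open>
  Write \<open>G\<close> for the Gram matrix of representatives of the three points under the form
  \<open>x\<^sub>1 x\<^sub>2 + y\<^sub>1 y\<^sub>2 - z\<^sub>1 z\<^sub>2\<close>. The joins are Lorentzian cross products, so their pairings are
  minors of \<open>G\<close> up to sign, and Jacobi's identity for the minors gives
  \<open>q\<^sub>2 q\<^sub>3 S\<^sub>1 = det G / (G\<^sub>1\<^sub>1 G\<^sub>2\<^sub>2 G\<^sub>3\<^sub>3)\<close>. Expanding the determinant,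
  \<open>q\<^sub>2 q\<^sub>3 S\<^sub>1 - q\<^sub>1 - q\<^sub>2 - q\<^sub>3 + 2 = 2 G\<^sub>1\<^sub>2 G\<^sub>1\<^sub>3 G\<^sub>2\<^sub>3 / (G\<^sub>1\<^sub>1 G\<^sub>2\<^sub>2 G\<^sub>3\<^sub>3)\<close>, whose square is the claim.
\<close>

text \<open>The quotient is partial, so facts such as \<open>lies_on.abs_eq\<close> ask for
  \<open>proportional u u\<close>; this reduces that condition to non-vanishing.\<close>

lemma proportional_self_iff: "proportional u u \<longleftrightarrow> u \<noteq> (0, 0, 0)"
  using proportional_refl by (auto simp: proportional_def)

lemma proportion_coordinates:
  fixes a :: "'a::field proportion"
  obtains x y z where "(x, y, z) \<noteq> (0, 0, 0)" "a = abs_proportion (x, y, z)"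
proof -
  have "\<exists>u. proportional u u \<and> a = abs_proportion u"
    by (induction a rule: proportion.abs_induct) blast
  then show ?thesis
    using that by (auto simp: proportional_self_iff)
qed

text \<open>The triple \<open>w\<close> is the cross product with its last entry negated, to match
  the minus sign in incidence. It vanishes only for proportional triples, and
  \<open>ex1_join\<close> makes it the join.\<close>

lemma join_abs_proportion:
  fixes x y z x' y' z' :: "'a::field"
  assumes u: "(x, y, z) \<noteq> (0, 0, 0)" and v: "(x', y', z') \<noteq> (0, 0, 0)"
    and neq: "abs_proportion (x, y, z) \<noteq> abs_proportion (x', y', z')"
  defines "w \<equiv> (y * z' - z * y', z * x' - x * z', y * x' - x * y')"
  shows "w \<noteq> (0, 0, 0)"
    and "join (abs_proportion (x, y, z)) (abs_proportion (x', y', z')) = abs_proportion w"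
proof -
  have "\<not> proportional (x, y, z) (x', y', z')"
    using neq Quotient3_rel_abs[OF Quotient3_proportion] by blast
  then show w: "w \<noteq> (0, 0, 0)"
    using proportional_if_cross_eq_0[OF u v] by (auto simp: w_def)
  have "lies_on (abs_proportion (x, y, z)) (abs_proportion w)"
       "lies_on (abs_proportion (x', y', z')) (abs_proportion w)"
    using u v w by (auto simp: lies_on.abs_eq proportional_self_iff w_def algebra_simps)
  then show "join (abs_proportion (x, y, z)) (abs_proportion (x', y', z')) = abs_proportion w"
    unfolding join_def by (intro the1_equality ex1_join neq conjI)
qed

text \<open>Coordinate-free core: \<open>A\<close>, \<open>B\<close>, \<open>C\<close> are the
  diagonal entries of the Gram matrix, and \<open>p\<close>, \<open>q\<close>, \<open>r\<close> the
  off-diagonal ones, each opposite its point.\<close>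

lemma gram_cross_law:
  fixes A B C p q r :: "'a::field"
  assumes nz: "A \<noteq> 0" "B \<noteq> 0" "C \<noteq> 0" "A * B - r\<^sup>2 \<noteq> 0" "A * C - q\<^sup>2 \<noteq> 0"
  defines "q1 \<equiv> 1 - p\<^sup>2 / (B * C)" and "q2 \<equiv> 1 - q\<^sup>2 / (A * C)" and "q3 \<equiv> 1 - r\<^sup>2 / (A * B)"
    and "S \<equiv> 1 - (A * p - r * q)\<^sup>2 / ((A * B - r\<^sup>2) * (A * C - q\<^sup>2))"
  shows "(q2 * q3 * S - q1 - q2 - q3 + 2)\<^sup>2 = 4 * (1 - q1) * (1 - q2) * (1 - q3)"
proof -
  have q23: "q2 = (A * C - q\<^sup>2) / (A * C)" "q3 = (A * B - r\<^sup>2) / (A * B)"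
    using nz by (simp_all add: q2_def q3_def diff_divide_distrib)
  have "S = ((A * B - r\<^sup>2) * (A * C - q\<^sup>2) - (A * p - r * q)\<^sup>2) / ((A * B - r\<^sup>2) * (A * C - q\<^sup>2))"
    using nz by (simp add: S_def diff_divide_distrib)
  \<comment> \<open>Jacobi's identity: the second factor on the right is the Gram determinant. The
    two minors then cancel against the numerators of \<open>q2\<close> and
    \<open>q3\<close>.\<close>
  also have "(A * B - r\<^sup>2) * (A * C - q\<^sup>2) - (A * p - r * q)\<^sup>2
      = A * (A * B * C + 2 * p * q * r - A * p\<^sup>2 - B * q\<^sup>2 - C * r\<^sup>2)"
    by algebra
  finally have "q2 * q3 * S = A * (A * B * C + 2 * p * q * r - A * p\<^sup>2 - B * q\<^sup>2 - C * r\<^sup>2)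
      / ((A * C) * (A * B))"
    using nz by (simp add: q23)
  also have "\<dots> = 1 + 2 * p * q * r / (A * B * C) - p\<^sup>2 / (B * C) - q\<^sup>2 / (A * C) - r\<^sup>2 / (A * B)"
    using nz by (simp add: field_simps)
  finally have *: "q2 * q3 * S - q1 - q2 - q3 + 2 = 2 * p * q * r / (A * B * C)"
    by (simp only:) (simp add: q1_def q2_def q3_def)
  have "1 - q1 = p\<^sup>2 / (B * C)" "1 - q2 = q\<^sup>2 / (A * C)" "1 - q3 = r\<^sup>2 / (A * B)"
    by (simp_all add: q1_def q2_def q3_def)
  then show ?thesis
    unfolding * by (simp add: power2_eq_square mult_ac)
qed

theorem theorem50:
  fixes a\<^sub>1 a\<^sub>2 a\<^sub>3 :: "'a::field point"
  assumes "CHAR('a) \<noteq> 2"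
    and "a\<^sub>1 \<noteq> a\<^sub>2" and "a\<^sub>1 \<noteq> a\<^sub>3" and "a\<^sub>2 \<noteq> a\<^sub>3"
    and "\<not> null_point a\<^sub>1" and "\<not> null_point a\<^sub>2" and "\<not> null_point a\<^sub>3"
    and "\<not> null_line (join a\<^sub>1 a\<^sub>2)" and "\<not> null_line (join a\<^sub>1 a\<^sub>3)"
  defines "q\<^sub>1 \<equiv> quadrance a\<^sub>2 a\<^sub>3"
    and "q\<^sub>2 \<equiv> quadrance a\<^sub>1 a\<^sub>3"
    and "q\<^sub>3 \<equiv> quadrance a\<^sub>1 a\<^sub>2"
    and "S\<^sub>1 \<equiv> spread (join a\<^sub>1 a\<^sub>2) (join a\<^sub>1 a\<^sub>3)"
  shows "(q\<^sub>2 * q\<^sub>3 * S\<^sub>1 - q\<^sub>1 - q\<^sub>2 - q\<^sub>3 + 2)\<^sup>2 = 4 * (1 - q\<^sub>1) * (1 - q\<^sub>2) * (1 - q\<^sub>3)"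
proof -
  obtain x y z where u: "(x, y, z) \<noteq> (0, 0, 0)" "a\<^sub>1 = abs_proportion (x, y, z)"
    by (rule proportion_coordinates)
  obtain x' y' z' where v: "(x', y', z') \<noteq> (0, 0, 0)" "a\<^sub>2 = abs_proportion (x', y', z')"
    by (rule proportion_coordinates)
  obtain x'' y'' z'' where w: "(x'', y'', z'') \<noteq> (0, 0, 0)" "a\<^sub>3 = abs_proportion (x'', y'', z'')"
    by (rule proportion_coordinates)
  define A B C where "A = x\<^sup>2 + y\<^sup>2 - z\<^sup>2" and "B = x'\<^sup>2 + y'\<^sup>2 - z'\<^sup>2" and "C = x''\<^sup>2 + y''\<^sup>2 - z''\<^sup>2"
  define p q r where "p = x' * x'' + y' * y'' - z' * z''" and "q = x * x'' + y * y'' - z * z''"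
    and "r = x * x' + y * y' - z * z'"
  note gram = A_def B_def C_def p_def q_def r_def
  note J2 = join_abs_proportion[OF u(1) v(1) assms(2)[unfolded u v]]
  note J3 = join_abs_proportion[OF u(1) w(1) assms(3)[unfolded u w]]
  note reps = u(1) v(1) w(1) J2(1) J3(1)
  note reps' = reps[folded proportional_self_iff]
  \<comment> \<open>Lorentzian forms of Lagrange's identity; the signature produces the minus
    signs.\<close>
  have N2: "(y * z' - z * y')\<^sup>2 + (z * x' - x * z')\<^sup>2 - (y * x' - x * y')\<^sup>2 = - (A * B - r\<^sup>2)"
    unfolding gram by algebra
  have N3: "(y * z'' - z * y'')\<^sup>2 + (z * x'' - x * z'')\<^sup>2 - (y * x'' - x * y'')\<^sup>2 = - (A * C - q\<^sup>2)"
    unfolding gram by algebra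
  have P: "(y * z' - z * y') * (y * z'' - z * y'') + (z * x' - x * z') * (z * x'' - x * z'')
      - (y * x' - x * y') * (y * x'' - x * y'') = - (A * p - r * q)"
    unfolding gram by algebra
  have "A \<noteq> 0" "B \<noteq> 0" "C \<noteq> 0"
    using assms(5-7) reps' by (auto simp: u(2) v(2) w(2) null_point.abs_eq gram)
  \<comment> \<open>Non-null joins are exactly non-zero minors.\<close>
  moreover have "A * B - r\<^sup>2 \<noteq> 0"
    using assms(8) unfolding u(2) v(2) J2(2) null_line.abs_eq[OF reps'(4)] prod.case N2 by simp
  moreover have "A * C - q\<^sup>2 \<noteq> 0"
    using assms(9) unfolding u(2) w(2) J3(2) null_line.abs_eq[OF reps'(5)] prod.case N3 by simp
  moreover have "q\<^sub>1 = 1 - p\<^sup>2 / (B * C)" "q\<^sub>2 = 1 - q\<^sup>2 / (A * C)" "q\<^sub>3 = 1 - r\<^sup>2 / (A * B)"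
    unfolding q\<^sub>1_def q\<^sub>2_def q\<^sub>3_def u(2) v(2) w(2) gram
    by (simp_all only: quadrance.abs_eq reps' prod.case)
  \<comment> \<open>The signs from \<open>N2\<close>, \<open>N3\<close> and \<open>P\<close>
    disappear: the numerator is squared and the denominator has two negated factors.\<close>
  moreover have "S\<^sub>1 = 1 - (A * p - r * q)\<^sup>2 / ((A * B - r\<^sup>2) * (A * C - q\<^sup>2))"
    unfolding S\<^sub>1_def u(2) v(2) w(2) J2(2) J3(2) spread.abs_eq[OF reps'(4,5)] prod.case N2 N3 P
    by (simp only: power2_minus minus_mult_minus)
  ultimately show ?thesis
    using gram_cross_law by metis
qed

end
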